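(* We have $$\lim_{n\to \infty}\frac{\#\{1\le k\le n\mid\mathrm{cp}_{5,1,6}(k) \text{ is even}\}}{n} = 1.$$ In particular, for a nonnegative integer $n$, $\mathrm{cp}_{5,1,6}(n)$ is even if some prime $p\equiv 2\pmod 3$ divides $6n+1$ to an odd power.
   Context: For integers $a,b,m\ge1$, an $(a,b,m)$-copartition is a triple of integer partitions $(\gamma,\rho,\sigma)$ such that every part of $\gamma$ is $\ge a$ and $\equiv a \pmod m$, every part of $\sigma$ is $\ge b$ and $\equiv b\pmod m$, and $\rho$ has exactly as many parts as $\sigma$, each part of $\rho$ being equal to $m$ times the number of parts of $\gamma$. Its size is the sum of all parts of $\gamma,\rho,\sigma$, and $\mathrm{cp}_{a,b,m}(n)$ denotes the number of $(a,b,m)$-copartitions of size $n$. *)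

theory Defs
  imports Complex_Main "HOL-Library.Multiset" "HOL-Number_Theory.Number_Theory"
begin

text \<open>
  Partitions are finite multisets of natural numbers. In \<open>\<gamma>\<close> and \<open>\<sigma>\<close> all parts are positive.
  If \<open>\<gamma>\<close> is empty, the parts of \<open>\<rho>\<close> are equal to \<open>m * 0 = 0\<close>: by convention such zero parts are
  allowed in \<open>\<rho>\<close>, so that a triple with \<open>\<gamma>\<close> empty and \<open>\<sigma>\<close> arbitrary is a copartition.
\<close>

definition is_copartition ::
    "nat \<Rightarrow> nat \<Rightarrow> nat \<Rightarrow> nat multiset \<times> nat multiset \<times> nat multiset \<Rightarrow> bool" where
  "is_copartition a b m = (\<lambda>(\<gamma>, \<rho>, \<sigma>).
     (\<forall>x \<in># \<gamma>. 0 < x \<and> a \<le> x \<and> [x = a] (mod m)) \<and>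
     (\<forall>x \<in># \<sigma>. 0 < x \<and> b \<le> x \<and> [x = b] (mod m)) \<and>
     size \<rho> = size \<sigma> \<and>
     (\<forall>x \<in># \<rho>. x = m * size \<gamma>))"

definition copartition_size :: "nat multiset \<times> nat multiset \<times> nat multiset \<Rightarrow> nat" where
  "copartition_size = (\<lambda>(\<gamma>, \<rho>, \<sigma>). sum_mset \<gamma> + sum_mset \<rho> + sum_mset \<sigma>)"

definition cp :: "nat \<Rightarrow> nat \<Rightarrow> nat \<Rightarrow> nat \<Rightarrow> nat" where
  "cp a b m n = card {c. is_copartition a b m c \<and> copartition_size c = n}"

end

theory Submission
  imports Defs "HOL-Computational_Algebra.Formal_Power_Series" "HOL-Library.Z2"
    "HOL-Analysis.Harmonic_Numbers"
begin

text \<open>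
  Write \<open>F\<^sub>a\<^sub>,\<^sub>b\<close> for the generating function of \<open>(a, b, m)\<close>-copartitions. Removing a part \<open>a\<close> from \<open>\<gamma>\<close>
  gives \<open>F\<^sub>a\<^sub>,\<^sub>b = F\<^sub>a\<^sub>+\<^sub>m\<^sub>,\<^sub>b + q\<^sup>a F\<^sub>a\<^sub>,\<^sub>b\<^sub>+\<^sub>m\<close>; combined with its mirror image this yields
  \<open>(1 - q\<^sup>a) F\<^sub>a\<^sub>,\<^sub>b = (1 - q\<^sup>a\<^sup>+\<^sup>b) F\<^sub>a\<^sub>+\<^sub>m\<^sub>,\<^sub>b\<close> and hence a product formula. Modulo 2 it reads
  \<open>F\<^sub>5\<^sub>,\<^sub>1 = (q; q)\<^sub>\<infinity> (q\<^sup>3; q\<^sup>3)\<^sub>\<infinity>\<close> for \<open>m = 6\<close>, so by the pentagonal number theorem an odd coefficient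
  at \<open>n\<close> forces \<open>4 (6 n + 1) = x\<^sup>2 + 3 y\<^sup>2\<close>. As \<open>-3\<close> is not a square modulo a prime \<open>p \<equiv> 2 (mod 3)\<close>,
  such primes divide \<open>6 n + 1\<close> to an even power. The density statement follows by sieving modulo \<open>p\<^sup>2\<close>
  over primes \<open>p \<equiv> 5 (mod 6)\<close>, because \<open>\<Prod>(1 + 1/p)/(1 - 1/p)\<close> over these primes diverges: it bounds
  \<open>\<Sum>1/n\<close> over \<open>n\<close> coprime to 6, as one sees by flipping the values of the nontrivial character
  modulo 6, whose partial sums \<open>\<Sum>\<chi>(n)/n\<close> are at most 1, at one prime after the other.
\<close>

section \<open>Recurrences for copartition numbers\<close>

definition progression_parts :: "nat \<Rightarrow> nat \<Rightarrow> nat multiset \<Rightarrow> bool" where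
  "progression_parts a m \<gamma> \<longleftrightarrow> (\<forall>x\<in>#\<gamma>. a \<le> x \<and> [x = a] (mod m))"

text \<open>The partition \<open>\<rho>\<close> is determined by the other two and sums to
  \<open>m * size \<gamma> * size \<sigma>\<close>, so it is eliminated.\<close>

definition copairs :: "nat \<Rightarrow> nat \<Rightarrow> nat \<Rightarrow> nat \<Rightarrow> (nat multiset \<times> nat multiset) set" where
  "copairs a b m n = {(\<gamma>, \<sigma>). progression_parts a m \<gamma> \<and> progression_parts b m \<sigma> \<and>
     sum_mset \<gamma> + sum_mset \<sigma> + m * size \<gamma> * size \<sigma> = n}"

lemma cp_eq_card_copairs:
  assumes "a > 0" "b > 0"
  shows "cp a b m n = card (copairs a b m n)"
proof -
  have rep: "size \<rho> = k \<and> (\<forall>x\<in>#\<rho>. x = c) \<longleftrightarrow> \<rho> = replicate_mset k c"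
    for \<rho> :: "nat multiset" and k c
    by (metis in_replicate_mset set_mset_subset_singletonD singleton_iff size_replicate_mset subsetI)
  have iff: "is_copartition a b m (\<gamma>, \<rho>, \<sigma>) \<longleftrightarrow> progression_parts a m \<gamma> \<and> progression_parts b m \<sigma> \<and>
      \<rho> = replicate_mset (size \<sigma>) (m * size \<gamma>)" for \<gamma> \<rho> \<sigma>
    unfolding is_copartition_def prod.case rep progression_parts_def using assms by fastforce
  have "bij_betw (\<lambda>(\<gamma>, \<sigma>). (\<gamma>, replicate_mset (size \<sigma>) (m * size \<gamma>), \<sigma>)) (copairs a b m n)
      {c. is_copartition a b m c \<and> copartition_size c = n}"
    by (rule bij_betw_byWitness[where f' = "\<lambda>(\<gamma>, \<rho>, \<sigma>). (\<gamma>, \<sigma>)"])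
      (auto simp: copairs_def iff copartition_size_def algebra_simps)
  then show ?thesis unfolding cp_def by (simp add: bij_betw_same_card)
qed

lemma size_le_sum_mset:
  assumes "\<forall>x\<in>#M. (0::nat) < x"
  shows "size M \<le> sum_mset M"
  using assms by (induction M) auto

text \<open>Parts are positive, so \<open>n\<close> bounds both their number and their values.
  Finiteness lets \<open>card\<close> split over disjoint cases.\<close>

lemma finite_copairs:
  assumes "a > 0" "b > 0"
  shows "finite (copairs a b m n)"
proof -
  let ?B = "mset ` {xs. set xs \<subseteq> {..n} \<and> length xs \<le> n}"
  have B: "M \<in> ?B" if M: "progression_parts c m M" "c > 0" "sum_mset M \<le> n" for M c
  proof -
    have "size M \<le> n"
      using size_le_sum_mset[of M] M by (fastforce simp: progression_parts_def)
    moreover have "x \<le> n" if "x \<in># M" for x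
      using that M(3) sum_mset.remove[OF that] by simp
    ultimately show ?thesis
      by (metis (mono_tags, lifting) atMost_iff ex_mset image_eqI mem_Collect_eq set_mset_mset size_mset subsetI)
  qed
  have "copairs a b m n \<subseteq> ?B \<times> ?B"
  proof
    fix c assume "c \<in> copairs a b m n"
    then obtain \<gamma> \<sigma> where "c = (\<gamma>, \<sigma>)" "progression_parts a m \<gamma>" "progression_parts b m \<sigma>"
      "sum_mset \<gamma> \<le> n" "sum_mset \<sigma> \<le> n" by (auto simp: copairs_def)
    with B[of a \<gamma>] B[of b \<sigma>] assms show "c \<in> ?B \<times> ?B" by blast
  qed
  moreover have "finite ?B"
    by (intro finite_imageI finite_lists_length_le) simp
  ultimately show ?thesis by (meson finite_SigmaI finite_subset)
qed

text \<open>With \<open>\<rho>\<close> eliminated, the size condition is symmetric in the two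
  partitions.\<close>

lemma cp_commute:
  assumes "a > 0" "b > 0"
  shows "cp a b m n = cp b a m n"
proof -
  have "bij_betw prod.swap (copairs a b m n) (copairs b a m n)"
    by (rule bij_betw_byWitness[where f' = prod.swap]) (auto simp: copairs_def algebra_simps)
  then show ?thesis using assms by (simp add: cp_eq_card_copairs bij_betw_same_card)
qed

lemma progression_parts_shift:
  assumes "m > 0"
  shows "progression_parts (a + m) m \<gamma> \<longleftrightarrow> progression_parts a m \<gamma> \<and> a \<notin># \<gamma>"
proof -
  have "a + m \<le> x \<and> [x = a + m] (mod m) \<longleftrightarrow> a \<le> x \<and> [x = a] (mod m) \<and> x \<noteq> a" for x
  proof -
    have "a + m \<le> x" if "a \<le> x" "[x = a] (mod m)" "x \<noteq> a"
    proof -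
      have "m dvd x - a" using that by (simp add: cong_altdef_nat)
      then have "m \<le> x - a" using that by (intro dvd_imp_le) auto
      then show ?thesis using that by simp
    qed
    then show ?thesis using assms by (auto simp: cong_def)
  qed
  then show ?thesis unfolding progression_parts_def by blast
qed

lemma progression_parts_add_mset [simp]:
  "progression_parts a m (add_mset x \<gamma>) \<longleftrightarrow> a \<le> x \<and> [x = a] (mod m) \<and> progression_parts a m \<gamma>"
  by (auto simp: progression_parts_def)

lemma progression_parts_translate:
  "progression_parts (a + m) m (image_mset (\<lambda>x. x + m) \<gamma>) \<longleftrightarrow> progression_parts a m \<gamma>"
  by (auto simp: progression_parts_def cong_def)

lemma sum_mset_translate:
  "sum_mset (image_mset (\<lambda>x. x + m) \<sigma>) = sum_mset \<sigma> + m * size (\<sigma> :: nat multiset)"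
  by (induction \<sigma>) auto

text \<open>Deleting a smallest part \<open>a\<close> of \<open>\<gamma>\<close> lowers every part of \<open>\<rho>\<close> by \<open>m\<close>; this loss is compensated
  by raising every part of \<open>\<sigma>\<close> by \<open>m\<close>.\<close>
lemma cp_recurrence:
  assumes "a > 0" "b > 0" "m > 0"
  shows "cp a b m n = cp (a + m) b m n + (if n < a then 0 else cp a (b + m) m (n - a))"
proof -
  let ?A = "{c \<in> copairs a b m n. a \<notin># fst c}" and ?B = "{c \<in> copairs a b m n. a \<in># fst c}"
  have A: "?A = copairs (a + m) b m n"
    using assms by (auto simp: copairs_def progression_parts_shift)
  have "card (copairs a b m n) = card (?A \<union> ?B)"
    by (intro arg_cong[where f = card]) auto
  also have "\<dots> = card ?A + card ?B"
    using finite_copairs[of a b m n] assms by (intro card_Un_disjoint) auto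
  also have "card ?B = (if n < a then 0 else card (copairs a (b + m) m (n - a)))"
  proof (cases "n < a")
    case True
    have "a \<notin># \<gamma>" if "(\<gamma>, \<sigma>) \<in> copairs a b m n" for \<gamma> \<sigma>
    proof
      assume "a \<in># \<gamma>"
      from sum_mset.remove[OF this] that True show False by (auto simp: copairs_def)
    qed
    then have "?B = {}" by auto
    then show ?thesis using True by (metis card.empty)
  next
    case False
    have "bij_betw (\<lambda>(\<gamma>, \<sigma>). (\<gamma> - {#a#}, image_mset (\<lambda>x. x + m) \<sigma>)) ?B (copairs a (b + m) m (n - a))"
    proof (rule bij_betw_byWitness[where f' = "\<lambda>(\<gamma>, \<sigma>). (add_mset a \<gamma>, image_mset (\<lambda>x. x - m) \<sigma>)"])
      \<comment> \<open>Truncated subtraction is exact here: every part of \<open>\<sigma>\<close>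
        is at least \<open>b + m\<close>.\<close>
      have inv: "image_mset (\<lambda>x. x + m) (image_mset (\<lambda>x. x - m) \<sigma>) = \<sigma>"
        if "progression_parts (b + m) m \<sigma>" for \<sigma>
      proof -
        have "image_mset (\<lambda>x. x - m + m) \<sigma> = image_mset (\<lambda>x. x) \<sigma>"
          using that by (intro image_mset_cong) (auto simp: progression_parts_def)
        then show ?thesis by (simp add: image_mset.compositionality o_def)
      qed
      show "\<forall>c\<in>?B. (case case c of (\<gamma>, \<sigma>) \<Rightarrow> (\<gamma> - {#a#}, image_mset (\<lambda>x. x + m) \<sigma>) of
          (\<gamma>, \<sigma>) \<Rightarrow> (add_mset a \<gamma>, image_mset (\<lambda>x. x - m) \<sigma>)) = c"
        by (auto simp: image_mset.compositionality o_def)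
      show "\<forall>c\<in>copairs a (b + m) m (n - a). (case case c of
          (\<gamma>, \<sigma>) \<Rightarrow> (add_mset a \<gamma>, image_mset (\<lambda>x. x - m) \<sigma>) of
          (\<gamma>, \<sigma>) \<Rightarrow> (\<gamma> - {#a#}, image_mset (\<lambda>x. x + m) \<sigma>)) = c"
        by (auto simp: copairs_def inv)
      show "(\<lambda>(\<gamma>, \<sigma>). (\<gamma> - {#a#}, image_mset (\<lambda>x. x + m) \<sigma>)) ` ?B \<subseteq> copairs a (b + m) m (n - a)"
      proof safe
        fix \<gamma> \<sigma> assume *: "(\<gamma>, \<sigma>) \<in> copairs a b m n" and "a \<in># fst (\<gamma>, \<sigma>)"
        then obtain \<gamma>' where "\<gamma> = add_mset a \<gamma>'" by (auto dest: multi_member_split)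
        with * show "(\<gamma> - {#a#}, image_mset (\<lambda>x. x + m) \<sigma>) \<in> copairs a (b + m) m (n - a)"
          by (auto simp: copairs_def progression_parts_translate sum_mset_translate algebra_simps)
      qed
      show "(\<lambda>(\<gamma>, \<sigma>). (add_mset a \<gamma>, image_mset (\<lambda>x. x - m) \<sigma>)) ` copairs a (b + m) m (n - a) \<subseteq> ?B"
      proof safe
        fix \<gamma> \<sigma> assume *: "(\<gamma>, \<sigma>) \<in> copairs a (b + m) m (n - a)"
        define \<sigma>' where "\<sigma>' = image_mset (\<lambda>x. x - m) \<sigma>"
        have "\<sigma> = image_mset (\<lambda>x. x + m) \<sigma>'" using inv[of \<sigma>] * by (simp add: copairs_def \<sigma>'_def)
        with * False show "(add_mset a \<gamma>, image_mset (\<lambda>x. x - m) \<sigma>) \<in> copairs a b m n"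
          unfolding \<sigma>'_def[symmetric]
          by (auto simp: copairs_def progression_parts_translate sum_mset_translate algebra_simps)
      qed auto
    qed
    then show ?thesis using False by (simp add: bij_betw_same_card)
  qed
  finally show ?thesis using assms A by (simp add: cp_eq_card_copairs)
qed

text \<open>Any part would exceed \<open>n\<close>, which leaves the empty copartition. Hence the
  series tends to 1 as \<open>a\<close> and \<open>b\<close> grow.\<close>

lemma cp_below_parts:
  assumes "n < a" "n < b"
  shows "cp a b m n = (if n = 0 then 1 else 0)"
proof -
  have *: "M = {#}" if "progression_parts c m M" "sum_mset M < c" for c M
    using that by (cases M) (auto simp: progression_parts_def)
  have "copairs a b m n = (if n = 0 then {({#}, {#})} else {})"
  proof -
    have "\<gamma> = {#} \<and> \<sigma> = {#}" if "(\<gamma>, \<sigma>) \<in> copairs a b m n" for \<gamma> \<sigma>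
      using that assms *[of a \<gamma>] *[of b \<sigma>] unfolding copairs_def by fastforce
    moreover have "({#}, {#}) \<in> copairs a b m n \<longleftrightarrow> n = 0"
      by (auto simp: copairs_def progression_parts_def)
    ultimately show ?thesis by auto
  qed
  then show ?thesis using assms by (simp add: cp_eq_card_copairs)
qed

section \<open>Generating functions\<close>

text \<open>The coefficient ring is left open so that the identities can be read over
  \<open>bit\<close>, where coefficients become parities.\<close>

definition cp_fps :: "nat \<Rightarrow> nat \<Rightarrow> nat \<Rightarrow> 'a::comm_ring_1 fps" where
  "cp_fps a b m = Abs_fps (\<lambda>n. of_nat (cp a b m n))"

lemma cp_fps_commute: "a > 0 \<Longrightarrow> b > 0 \<Longrightarrow> cp_fps a b m = cp_fps b a m"
  by (simp add: cp_fps_def cp_commute)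

lemma cp_fps_recurrence:
  assumes "a > 0" "b > 0" "m > 0"
  shows "cp_fps a b m = cp_fps (a + m) b m + fps_X ^ a * cp_fps a (b + m) m"
  using assms by (intro fps_ext) (simp add: cp_fps_def fps_X_power_mult_nth cp_recurrence[of a b m])

text \<open>The recurrence and its mirror image share the term \<open>cp_fps a (b + m) m\<close>;
  eliminating it leaves a shift in \<open>a\<close> alone.\<close>

lemma cp_fps_shift_left:
  assumes "a > 0" "b > 0" "m > 0"
  shows "cp_fps a b m * (1 - fps_X ^ a) = (cp_fps (a + m) b m :: 'a::comm_ring_1 fps) * (1 - fps_X ^ (a + b))"
proof -
  let ?F = "\<lambda>a b. cp_fps a b m :: 'a fps"
  have 1: "?F a b = ?F (a + m) b + fps_X ^ a * ?F a (b + m)"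
    by (rule cp_fps_recurrence) fact+
  have "?F a b = ?F a (b + m) + fps_X ^ b * ?F (a + m) b"
    using cp_fps_recurrence[of b a m, where 'a = 'a] assms
    by (simp add: cp_fps_commute[of _ a] cp_fps_commute[of b])
  then have 2: "?F a (b + m) = ?F a b - fps_X ^ b * ?F (a + m) b"
    by simp
  have "?F a b = ?F (a + m) b + fps_X ^ a * (?F a b - fps_X ^ b * ?F (a + m) b)"
    using 1 unfolding 2 .
  then show ?thesis by (simp add: algebra_simps power_add)
qed

lemma cp_fps_shift_left_prod:
  assumes "a > 0" "b > 0" "m > 0"
  shows "cp_fps a b m * (\<Prod>i<N. 1 - fps_X ^ (a + m * i)) =
    (cp_fps (a + m * N) b m :: 'a::comm_ring_1 fps) * (\<Prod>i<N. 1 - fps_X ^ (a + b + m * i))"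
proof (induction N)
  case (Suc N)
  let ?F = "\<lambda>a. cp_fps a b m :: 'a fps"
  have "?F a * (\<Prod>i<Suc N. 1 - fps_X ^ (a + m * i)) =
      ?F a * (\<Prod>i<N. 1 - fps_X ^ (a + m * i)) * (1 - fps_X ^ (a + m * N))"
    by (simp add: mult.assoc)
  also have "\<dots> = (?F (a + m * N) * (1 - fps_X ^ (a + m * N))) * (\<Prod>i<N. 1 - fps_X ^ (a + b + m * i))"
    unfolding Suc by (simp only: mult_ac)
  also have "?F (a + m * N) * (1 - fps_X ^ (a + m * N)) =
      ?F (a + m * Suc N) * (1 - fps_X ^ (a + b + m * N))"
    using cp_fps_shift_left[of "a + m * N" b m, where 'a = 'a] assms
    by (simp add: add_ac)
  finally show ?case by (simp add: mult_ac)
qed simp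

text \<open>Congruence modulo \<open>fps_X ^ N\<close>, by which infinite products are handled
  through finite truncations.\<close>

definition fps_cong :: "nat \<Rightarrow> 'a fps \<Rightarrow> 'a fps \<Rightarrow> bool" where
  "fps_cong N f g \<longleftrightarrow> (\<forall>k<N. fps_nth f k = fps_nth g k)"

lemma fps_cong_refl [simp]: "fps_cong N f f"
  by (simp add: fps_cong_def)

lemma fps_cong_sym: "fps_cong N f g \<Longrightarrow> fps_cong N g f"
  by (simp add: fps_cong_def)

lemma fps_cong_trans [trans]: "fps_cong N f g \<Longrightarrow> fps_cong N g h \<Longrightarrow> fps_cong N f h"
  by (simp add: fps_cong_def)

lemma fps_cong_mult: "fps_cong N f g \<Longrightarrow> fps_cong N f' g' \<Longrightarrow> fps_cong N (f * f') (g * g')"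
  by (simp add: fps_cong_def fps_mult_nth)

lemma fps_cong_prod_1:
  assumes "\<And>i. i \<in> I \<Longrightarrow> fps_cong N (f i) 1"
  shows "fps_cong N (\<Prod>i\<in>I. f i) 1"
  using assms
proof (induction I rule: infinite_finite_induct)
  case (insert x I)
  then show ?case using fps_cong_mult[of N "f x" 1 "prod f I" 1] by simp
qed simp_all

lemma fps_cong_one_minus_X_power: "N \<le> k \<Longrightarrow> fps_cong N (1 - fps_X ^ k :: 'a::comm_ring_1 fps) 1"
  by (auto simp: fps_cong_def fps_X_power_nth)

lemma cp_fps_cong_1: "N \<le> a \<Longrightarrow> N \<le> b \<Longrightarrow> fps_cong N (cp_fps a b m) 1"
  by (auto simp: fps_cong_def cp_fps_def cp_below_parts)

text \<open>Truncated form of \<open>\<Sum>\<^sub>n cp\<^sub>a\<^sub>,\<^sub>b\<^sub>,\<^sub>m(n) q\<^sup>n = (q\<^sup>a\<^sup>+\<^sup>b; q\<^sup>m)\<^sub>\<infinity> / ((q\<^sup>a; q\<^sup>m)\<^sub>\<infinity> (q\<^sup>b; q\<^sup>m)\<^sub>\<infinity>)\<close>.\<close>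
lemma cp_fps_product:
  assumes "a > 0" "b > 0" "m > 0"
  shows "fps_cong N (cp_fps a b m * (\<Prod>i<N. 1 - fps_X ^ (a + m * i)) * (\<Prod>i<N. 1 - fps_X ^ (b + m * i)))
    (\<Prod>i<N. 1 - fps_X ^ (a + b + m * i) :: 'a::comm_ring_1 fps)"
proof -
  let ?P = "\<lambda>c. \<Prod>i<N. 1 - fps_X ^ (c + m * i) :: 'a fps"
  have N: "N \<le> c + m * N" for c using assms by (simp add: trans_le_add2)
  have "cp_fps a b m * ?P a * ?P b = cp_fps b (a + m * N) m * ?P b * ?P (a + b)"
    using cp_fps_shift_left_prod[of a b m N, where 'a = 'a] assms
    by (simp add: cp_fps_commute[of _ b] mult.assoc mult.left_commute[of _ "?P b"])
  \<comment> \<open>Shifting \<open>b\<close> as well pushes both parameters of the series and all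
    exponents of the new product to at least \<open>N\<close>, so modulo \<open>fps_X ^ N\<close>
    only \<open>?P (a + b)\<close> survives.\<close>
  also have "\<dots> = cp_fps (b + m * N) (a + m * N) m * ?P (b + (a + m * N)) * ?P (a + b)"
    using cp_fps_shift_left_prod[of b "a + m * N" m N, where 'a = 'a] assms by simp
  finally have eq: "cp_fps a b m * ?P a * ?P b = \<dots>" .
  have "fps_cong N \<dots> (1 * 1 * ?P (a + b))"
    using N[of a] N[of b]
    by (intro fps_cong_mult fps_cong_refl cp_fps_cong_1 fps_cong_prod_1 fps_cong_one_minus_X_power) auto
  then show ?thesis unfolding eq by simp
qed

section \<open>Finite Euler products \<open>(q; q)_n\<close> and the generating function modulo
  2\<close>

definition euler_prod :: "'a::comm_ring_1 \<Rightarrow> nat \<Rightarrow> 'a" where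
  "euler_prod q n = (\<Prod>i<n. 1 - q ^ Suc i)"

lemma euler_prod_Suc [simp]: "euler_prod q (Suc n) = euler_prod q n * (1 - q ^ Suc n)"
  and euler_prod_0 [simp]: "euler_prod q 0 = 1"
  by (simp_all add: euler_prod_def)

text \<open>Exponents are sorted modulo 6: residues 5 and 1 give the denominators of the product
  formula, the even ones an Euler product in \<open>q\<^sup>2\<close>.\<close>

lemma euler_prod_split_6:
  "euler_prod q (6 * N) = (\<Prod>i<N. 1 - q ^ (5 + 6 * i)) * (\<Prod>i<N. 1 - q ^ (1 + 6 * i)) *
     (\<Prod>i<N. 1 - q ^ (3 + 6 * i)) * euler_prod (q\<^sup>2) (3 * N)"
proof (induction N)
  case (Suc N)
  have 6: "6 * Suc N = Suc (Suc (Suc (Suc (Suc (Suc (6 * N))))))"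
    and 3: "3 * Suc N = Suc (Suc (Suc (3 * N)))" by simp_all
  have pw: "(q\<^sup>2) ^ k = q ^ (2 * k)" for k by (simp add: power_mult)
  have e: "1 - (q\<^sup>2) ^ Suc (3 * N) = 1 - q ^ (2 + 6 * N)"
    "1 - (q\<^sup>2) ^ Suc (Suc (3 * N)) = 1 - q ^ (4 + 6 * N)"
    "1 - (q\<^sup>2) ^ Suc (Suc (Suc (3 * N))) = 1 - q ^ (6 + 6 * N)"
  proof -
    have "2 * Suc (3 * N) = 2 + 6 * N" "2 * Suc (Suc (3 * N)) = 4 + 6 * N"
      "2 * Suc (Suc (Suc (3 * N))) = 6 + 6 * N" by simp_all
    then show "1 - (q\<^sup>2) ^ Suc (3 * N) = 1 - q ^ (2 + 6 * N)"
      "1 - (q\<^sup>2) ^ Suc (Suc (3 * N)) = 1 - q ^ (4 + 6 * N)"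
      "1 - (q\<^sup>2) ^ Suc (Suc (Suc (3 * N))) = 1 - q ^ (6 + 6 * N)"
      unfolding pw by (simp_all only:)
  qed
  have e': "Suc (6 * N) = 1 + 6 * N" "Suc (1 + 6 * N) = 2 + 6 * N" "Suc (2 + 6 * N) = 3 + 6 * N"
    "Suc (3 + 6 * N) = 4 + 6 * N" "Suc (4 + 6 * N) = 5 + 6 * N" "Suc (5 + 6 * N) = 6 + 6 * N"
    by simp_all
  show ?case unfolding 6 3 euler_prod_Suc Suc e prod.lessThan_Suc
    unfolding e' by (simp only: mult_ac)
qed simp

text \<open>Merges the leftover residue class 3 with the numerator of the product formula, whose
  exponents are the multiples of 6.\<close>

lemma euler_prod_split_3:
  "euler_prod (q ^ 3) (2 * N) = (\<Prod>i<N. 1 - q ^ (3 + 6 * i)) * (\<Prod>i<N. 1 - q ^ (6 + 6 * i))"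
proof (induction N)
  case (Suc N)
  have 2: "2 * Suc N = Suc (Suc (2 * N))" by simp
  have pw: "(q ^ 3) ^ k = q ^ (3 * k)" for k by (simp add: power_mult)
  have e: "1 - (q ^ 3) ^ Suc (2 * N) = 1 - q ^ (3 + 6 * N)"
    "1 - (q ^ 3) ^ Suc (Suc (2 * N)) = 1 - q ^ (6 + 6 * N)"
    unfolding pw by (simp_all add: add.commute)
  show ?case unfolding 2 euler_prod_Suc Suc e prod.lessThan_Suc by (simp only: mult_ac)
qed simp

lemma euler_prod_fps_cong:
  assumes "c > 0" "N \<le> n"
  shows "fps_cong N (euler_prod (fps_X ^ c) n :: 'a::comm_ring_1 fps) (euler_prod (fps_X ^ c) N)"
  using assms(2)
proof (induction n rule: dec_induct)
  case (step n)
  have "n < c * Suc n" using assms(1) by (cases c) auto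
  then have "fps_cong N (1 - fps_X ^ (c * Suc n) :: 'a fps) 1"
    using step by (intro fps_cong_one_minus_X_power) linarith
  then have "fps_cong N (euler_prod (fps_X ^ c) n * (1 - fps_X ^ (c * Suc n)) :: 'a fps)
      (euler_prod (fps_X ^ c) N * 1)"
    by (intro fps_cong_mult step.IH)
  then show ?case by (simp only: euler_prod_Suc power_mult mult_1_right)
qed simp

text \<open>Frobenius: the cross term of \<open>(1 - q ^ k)\<^sup>2\<close> vanishes and signs do
  not matter.\<close>

lemma euler_prod_square_char_2:
  assumes "(2::'a::comm_ring_1) = 0"
  shows "euler_prod (q\<^sup>2) n = (euler_prod q n :: 'a)\<^sup>2"
proof -
  have "1 - (q\<^sup>2) ^ k = (1 - q ^ k)\<^sup>2" for k
  proof -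
    have "(1 - q ^ k)\<^sup>2 = 1 - (q ^ k)\<^sup>2 + 2 * ((q ^ k)\<^sup>2 - q ^ k)"
      by (simp add: power2_eq_square algebra_simps)
    then show ?thesis using assms by (simp add: mult.commute flip: power_mult)
  qed
  then show ?thesis by (simp only: euler_prod_def prod_power_distrib)
qed

lemma euler_prod_fps_nth_0: "c > 0 \<Longrightarrow> fps_nth (euler_prod (fps_X ^ c) n :: 'a::comm_ring_1 fps) 0 = 1"
  by (induction n) (auto simp flip: power_mult power_Suc)

lemma cp_5_1_6_fps_char_2:
  assumes "(2::'a::field) = 0"
  shows "fps_cong N (cp_fps 5 1 6 :: 'a fps) (euler_prod fps_X N * euler_prod (fps_X ^ 3) N)"
proof -
  let ?F = "cp_fps 5 1 6 :: 'a fps" and ?E = "\<lambda>c n. euler_prod (fps_X ^ c :: 'a fps) n"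
  let ?P = "\<lambda>c. \<Prod>i<N. 1 - fps_X ^ (c + 6 * i) :: 'a fps"
  have two: "(2 :: 'a fps) = 0"
    using assms by (metis fps_const_0_eq_0 numeral_fps_const)
  have cong: "fps_cong N (?E c n) (?E c N)" if "c > 0" "N \<le> n" for c n
    using that by (rule euler_prod_fps_cong)
  \<comment> \<open>Length \<open>6 * N\<close> completes every residue class modulo 6; the extra
    factors are invisible modulo \<open>fps_X ^ N\<close>.\<close>
  have "fps_cong N (?F * ?E 1 N) (?F * ?E 1 (6 * N))"
    by (intro fps_cong_mult fps_cong_refl fps_cong_sym[OF cong]) auto
  also have "?F * ?E 1 (6 * N) = (?F * ?P 5 * ?P 1) * (?P 3 * ?E 2 (3 * N))"
    unfolding power_one_right euler_prod_split_6 by (simp only: mult_ac)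
  also have "fps_cong N \<dots> (?P 6 * (?P 3 * ?E 2 (3 * N)))"
    using cp_fps_product[of 5 1 6 N, where 'a = 'a] by (intro fps_cong_mult fps_cong_refl) simp
  also have "?P 6 * (?P 3 * ?E 2 (3 * N)) = ?E 3 (2 * N) * ?E 2 (3 * N)"
    unfolding euler_prod_split_3 by (simp only: mult_ac)
  also have "fps_cong N \<dots> (?E 3 N * ?E 2 N)"
    by (intro fps_cong_mult cong) auto
  also have "?E 3 N * ?E 2 N = ?E 1 N * ?E 3 N * ?E 1 N"
    using euler_prod_square_char_2[OF two, of fps_X N] by (simp add: power2_eq_square mult_ac)
  \<comment> \<open>An Euler product common to both sides is cancelled; its constant term 1 makes it
    invertible.\<close>
  finally have "fps_cong N (?F * ?E 1 N * inverse (?E 1 N)) (?E 1 N * ?E 3 N * ?E 1 N * inverse (?E 1 N))"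
    by (rule fps_cong_mult) (rule fps_cong_refl)
  moreover have "?E 1 N * inverse (?E 1 N) = 1"
    using euler_prod_fps_nth_0[of 1 N, where 'a = 'a] by (intro inverse_mult_eq_1') auto
  ultimately show ?thesis by (simp add: mult.assoc)
qed

text \<open>The product is the quotient \<open>(q; q)_n / (q; q)_s\<close> written without division,
  and \<open>\<Sum>{..s}\<close> is a triangular number.\<close>

definition shanks_term :: "'a::comm_ring_1 \<Rightarrow> nat \<Rightarrow> nat \<Rightarrow> 'a" where
  "shanks_term q n s = (-1) ^ s * (\<Prod>i\<in>{s<..n}. 1 - q ^ i) * q ^ (s * n + \<Sum>{..s})"

text \<open>Shanks' finite form of Euler's pentagonal number theorem.\<close>
lemma shanks_identity:
  "(\<Sum>s\<le>n. shanks_term q n s) =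
    1 + (\<Sum>k<n. (-1) ^ Suc k * (q ^ (Suc k * Suc k + \<Sum>{..Suc k}) + q ^ (Suc k * k + \<Sum>{..Suc k})))"
proof (induction n)
  case 0
  then show ?case by (simp add: shanks_term_def)
next
  case (Suc n)
  define e where "e = shanks_term q n"
  \<comment> \<open>Telescoping quantity, equal to \<open>e s * (1 - q ^ s)\<close> as well: passing
    from \<open>n\<close> to \<open>Suc n\<close> changes term \<open>s\<close> by
    \<open>a (Suc s) - a s\<close>. As \<open>a 0 = 0\<close>, only \<open>a (Suc n)\<close>
    remains; it and the new term \<open>s = Suc n\<close> are the two new pentagonal powers.\<close>
  define a where "a s = (case s of 0 \<Rightarrow> 0 | Suc s' \<Rightarrow> - e s' * q ^ (n + 1 + s'))" for s
  have a_eq: "a s = e s * (1 - q ^ s)" if "s \<le> n" for s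
  proof (cases s)
    case (Suc s')
    with that have "{s'<..n} = insert (Suc s') {Suc s'<..n}" by auto
    then have G: "(\<Prod>i\<in>{s'<..n}. 1 - q ^ i) = (1 - q ^ Suc s') * (\<Prod>i\<in>{Suc s'<..n}. 1 - q ^ i)"
      by simp
    have C: "q ^ (s' * n + \<Sum>{..s'}) * q ^ (n + 1 + s') = q ^ (Suc s' * n + \<Sum>{..Suc s'})"
      unfolding power_add[symmetric] by (simp add: add_ac)
    show ?thesis
      unfolding Suc a_def e_def shanks_term_def nat.case power_Suc[of "-1"] G C[symmetric]
      by (simp only: mult_minus_left mult_minus_right mult_1_left mult_ac)
  qed (simp add: a_def)
  have step: "shanks_term q (Suc n) s = e s + (a (Suc s) - a s)" if "s \<le> n" for s
  proof -
    have "{s<..Suc n} = insert (Suc n) {s<..n}" using that by auto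
    then have "shanks_term q (Suc n) s = e s * (1 - q ^ Suc n) * q ^ s"
      by (simp add: shanks_term_def e_def power_add algebra_simps)
    then show ?thesis
      unfolding a_eq[OF that] by (simp add: a_def power_add algebra_simps)
  qed
  have "(\<Sum>s\<le>Suc n. shanks_term q (Suc n) s) =
      (\<Sum>s\<le>n. e s) + (\<Sum>s<Suc n. a (Suc s) - a s) + shanks_term q (Suc n) (Suc n)"
    by (simp add: step sum.distrib lessThan_Suc_atMost del: sum.lessThan_Suc)
  also have "(\<Sum>s<Suc n. a (Suc s) - a s) = a (Suc n)"
    unfolding sum_lessThan_telescope by (simp add: a_def)
  also have "a (Suc n) = (-1) ^ Suc n * q ^ (Suc n * n + \<Sum>{..Suc n})"
    by (simp add: a_def e_def shanks_term_def power_add algebra_simps)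
  also have "shanks_term q (Suc n) (Suc n) = (-1) ^ Suc n * q ^ (Suc n * Suc n + \<Sum>{..Suc n})"
    by (simp add: shanks_term_def)
  finally show ?case using Suc unfolding e_def by (simp only: sum.lessThan_Suc algebra_simps)
qed

text \<open>With \<open>j = Suc k\<close> the exponents are the generalised pentagonal numbers
  \<open>j * (3 * j + 1) div 2\<close> and \<open>j * (3 * j - 1) div 2\<close>; the identities
  complete the square.\<close>

lemma pentagonal_square:
  "24 * (Suc k * Suc k + \<Sum>{..Suc k}) + 1 = (6 * k + 7)\<^sup>2"
  "24 * (Suc k * k + \<Sum>{..Suc k}) + 1 = (6 * k + 5)\<^sup>2"
proof -
  have "2 * \<Sum>{..Suc k} = Suc k * Suc (Suc k)" for k :: nat
    by (induction k) auto
  from this[of k] show "24 * (Suc k * Suc k + \<Sum>{..Suc k}) + 1 = (6 * k + 7)\<^sup>2"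
    "24 * (Suc k * k + \<Sum>{..Suc k}) + 1 = (6 * k + 5)\<^sup>2"
    by (simp_all add: power2_eq_square algebra_simps)
qed

text \<open>Up to degree \<open>n\<close>, Shanks' sum agrees with its term \<open>s = 0\<close>,
  the Euler product, while the other side has pentagonal exponents only.\<close>

lemma euler_prod_fps_nth_nonzero:
  assumes "c > 0" "j \<le> n" and nz: "fps_nth (euler_prod (fps_X ^ c) n :: 'a::comm_ring_1 fps) j \<noteq> 0"
  shows "\<exists>e x. j = c * e \<and> 24 * e + 1 = x\<^sup>2"
proof (rule ccontr)
  assume no: "\<not> ?thesis"
  let ?q = "fps_X ^ c :: 'a fps"
  have pow: "?q ^ e = fps_X ^ (c * e)" for e
    by (simp add: power_mult)
  have mono: "fps_nth (?q ^ e) j = 0" if "24 * e + 1 = x\<^sup>2" for e x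
    unfolding pow using no that by (auto simp: fps_X_power_nth)
  have mono2: "fps_nth ((-1) ^ Suc k * (?q ^ (Suc k * Suc k + \<Sum>{..Suc k}) + ?q ^ (Suc k * k + \<Sum>{..Suc k}))) j = 0" for k
  proof -
    have sign: "fps_nth ((-1) ^ k * f) j = 0" if "fps_nth f j = 0" for k and f :: "'a fps"
      by (simp add: that minus_one_power_iff)
    show ?thesis
      by (intro sign) (simp only: fps_add_nth mono[OF pentagonal_square(1)] mono[OF pentagonal_square(2)] add_0)
  qed
  have high: "fps_nth (shanks_term ?q n s) j = 0" if "s > 0" for s
  proof -
    have "n < s * n + \<Sum>{..s}" using that by (cases s) auto
    also have "\<dots> \<le> c * (s * n + \<Sum>{..s})" using assms(1) by simp
    finally show ?thesis
      unfolding shanks_term_def pow using assms(2) by (simp add: fps_X_power_mult_right_nth)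
  qed
  have "euler_prod ?q n = shanks_term ?q n 0"
    by (simp add: euler_prod_def shanks_term_def prod.atLeast1_atMost_eq flip: atLeastSucAtMost_greaterThanAtMost)
  then have "fps_nth (euler_prod ?q n) j = (\<Sum>s\<le>n. fps_nth (shanks_term ?q n s) j)"
    by (simp add: sum.remove[of "{..n}" 0] high)
  also have "\<dots> = fps_nth (?q ^ 0) j"
    unfolding fps_sum_nth[symmetric] shanks_identity fps_add_nth by (simp only: fps_sum_nth mono2) simp
  \<comment> \<open>Exponent 0 counts as pentagonal too:
    \<open>24 * 0 + 1 = 1\<^sup>2\<close>.\<close>
  also have "\<dots> = 0"
    by (rule mono[of 0 1]) simp
  finally show False using nz by simp
qed

text \<open>A nonzero coefficient of the product needs \<open>n = i + 3 * e\<close> with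
  \<open>24 * i + 1\<close> and \<open>24 * e + 1\<close> squares; these are added with weights 1
  and 3.\<close>

lemma odd_cp_5_1_6_imp_quadratic_form:
  assumes "odd (cp 5 1 6 n)"
  shows "\<exists>x y. 24 * n + 4 = x\<^sup>2 + 3 * y\<^sup>2"
proof -
  have "fps_nth (cp_fps 5 1 6 :: bit fps) n \<noteq> 0"
    using assms even_of_nat_iff[of "cp 5 1 6 n", where 'a = bit] by (auto simp: cp_fps_def)
  moreover have "fps_cong (Suc n) (cp_fps 5 1 6 :: bit fps)
      (euler_prod fps_X (Suc n) * euler_prod (fps_X ^ 3) (Suc n))"
    by (rule cp_5_1_6_fps_char_2) simp
  ultimately have "fps_nth (euler_prod fps_X (Suc n) * euler_prod (fps_X ^ 3) (Suc n) :: bit fps) n \<noteq> 0"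
    by (simp add: fps_cong_def)
  then obtain i where i: "i \<le> n" "fps_nth (euler_prod fps_X (Suc n) :: bit fps) i \<noteq> 0"
      "fps_nth (euler_prod (fps_X ^ 3) (Suc n) :: bit fps) (n - i) \<noteq> 0"
    unfolding fps_mult_nth
    by (metis (no_types, lifting) atLeastAtMost_iff mult_eq_0_iff sum.neutral)
  from i euler_prod_fps_nth_nonzero[of 1 i "Suc n", where 'a = bit]
  obtain x where x: "24 * i + 1 = x\<^sup>2" by auto
  have "n - i \<le> Suc n" by simp
  from euler_prod_fps_nth_nonzero[OF _ this i(3)]
  obtain e y where y: "n - i = 3 * e" "24 * e + 1 = y\<^sup>2" by auto
  have "24 * n + 4 = x\<^sup>2 + 3 * y\<^sup>2" using x y i(1) by linarith
  then show ?thesis by blast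
qed

section \<open>The quadratic form\<close>

text \<open>Cubing is injective modulo \<open>p\<close> because 3 does not divide
  \<open>p - 1\<close>. As the form divides \<open>a ^ 3 - b ^ 3\<close>, units \<open>a\<close> and
  \<open>b\<close> would agree modulo \<open>p\<close>, and \<open>p\<close> would divide
  \<open>3 * b\<^sup>2\<close>.\<close>

lemma prime_dvd_quadratic_form:
  fixes a b :: int
  assumes p: "prime p" "[p = 2] (mod 3)" and dvd: "int p dvd a\<^sup>2 + a * b + b\<^sup>2"
  shows "int p dvd a \<and> int p dvd b"
proof -
  have p': "prime (int p)" using p(1) by simp
  have p3: "\<not> int p dvd 3"
  proof
    assume "int p dvd 3"
    then have "p dvd 3" by presburger
    then have "p = 3" using p(1) by (intro primes_dvd_imp_eq) simp_all
    with p(2) show False by (simp add: cong_def)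
  qed
  have sq: "int p dvd x" if "int p dvd x\<^sup>2 + x * y + y\<^sup>2" "int p dvd y" for x y
  proof -
    have "int p dvd (x\<^sup>2 + x * y + y\<^sup>2) - y * (x + y)"
      using that by (intro dvd_diff) auto
    then have "int p dvd x\<^sup>2" by (simp add: power2_eq_square algebra_simps)
    then show ?thesis using p' prime_dvd_power by blast
  qed
  have "int p dvd a \<or> int p dvd b"
  proof (rule ccontr)
    assume "\<not> ?thesis"
    then have na: "\<not> int p dvd a" and nb: "\<not> int p dvd b" by auto
    define k where "k = p div 3"
    have k: "p - 1 = Suc (3 * k)"
    proof -
      have "p mod 3 = 2" using p(2) by (simp add: cong_def)
      then show ?thesis unfolding k_def by presburger
    qed
    have "int p dvd (a - b) * (a\<^sup>2 + a * b + b\<^sup>2)" using dvd by simp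
    also have "(a - b) * (a\<^sup>2 + a * b + b\<^sup>2) = a ^ 3 - b ^ 3"
      by (simp add: power2_eq_square power3_eq_cube algebra_simps)
    finally have "[a ^ 3 = b ^ 3] (mod int p)" by (simp add: cong_iff_dvd_diff)
    then have cubes: "[a ^ (3 * k) = b ^ (3 * k)] (mod int p)"
      unfolding power_mult by (rule cong_pow)
    have fermat: "[x ^ (p - 1) = 1] (mod int p)" if "\<not> int p dvd x" for x
    proof -
      define r where "r = nat (x mod int p)"
      have r: "[int r = x] (mod int p)"
        using p(1) by (simp add: r_def cong_def prime_gt_0_nat)
      then have "\<not> p dvd r" using that by (metis cong_dvd_iff int_dvd_int_iff)
      then have "[int (r ^ (p - 1)) = int 1] (mod int p)"
        unfolding cong_int_iff using p(1) by (intro fermat_theorem)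
      then show ?thesis using cong_pow[OF r, of "p - 1"] by (metis cong_sym cong_trans of_nat_1 of_nat_power)
    qed
    \<comment> \<open>Both sides are 1 by Fermat, as \<open>p - 1 = Suc (3 * k)\<close>; the equal
      powers of the cubes then cancel.\<close>
    have "[a * a ^ (3 * k) = b * b ^ (3 * k)] (mod int p)"
      using fermat[OF na] fermat[OF nb] unfolding k power_Suc by (metis cong_sym cong_trans)
    also have "[b * b ^ (3 * k) = b * a ^ (3 * k)] (mod int p)"
      using cubes by (intro cong_mult cong_refl) (rule cong_sym)
    finally have "[a * a ^ (3 * k) = b * a ^ (3 * k)] (mod int p)" .
    moreover have "coprime (a ^ (3 * k)) (int p)"
      using prime_imp_coprime[OF p' na] by (simp add: coprime_commute)
    ultimately have "[a = b] (mod int p)" by (simp add: cong_mult_rcancel)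
    then have "int p dvd a - b" by (simp add: cong_iff_dvd_diff)
    then have "int p dvd (a\<^sup>2 + a * b + b\<^sup>2) - (a - b) * (a + 2 * b)"
      using dvd by (intro dvd_diff) auto
    also have "\<dots> = 3 * b\<^sup>2" by (simp add: power2_eq_square algebra_simps)
    finally have "int p dvd 3 * b\<^sup>2" .
    then have "int p dvd 3 \<or> int p dvd b\<^sup>2" using p' prime_dvd_mult_iff by blast
    then show False using p3 nb prime_dvd_power[OF p'] by blast
  qed
  moreover have "int p dvd b\<^sup>2 + b * a + a\<^sup>2" using dvd by (simp add: algebra_simps)
  ultimately show ?thesis using sq[of a b] sq[of b a] dvd by blast
qed

text \<open>Descent: if \<open>p\<close> divides a positive value it divides both arguments, so
  \<open>p\<^sup>2\<close> splits off and a smaller value of the form remains.\<close>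

lemma even_multiplicity_quadratic_form:
  fixes a b :: int
  assumes p: "prime p" "[p = 2] (mod 3)" and "int M = a\<^sup>2 + a * b + b\<^sup>2"
  shows "even (multiplicity p M)"
  using assms(3)
proof (induction M arbitrary: a b rule: less_induct)
  case (less M)
  show ?case
  proof (cases "p dvd M \<and> M > 0")
    case True
    then have "int p dvd a\<^sup>2 + a * b + b\<^sup>2" unfolding less.prems[symmetric] by simp
    from prime_dvd_quadratic_form[OF p this] obtain a' b' where ab: "a = int p * a'" "b = int p * b'"
      by (auto elim!: dvdE)
    define M' where "M' = nat (a'\<^sup>2 + a' * b' + b'\<^sup>2)"
    have eq: "int M = int p ^ 2 * (a'\<^sup>2 + a' * b' + b'\<^sup>2)"
      unfolding less.prems ab by (simp add: power2_eq_square algebra_simps)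
    have "p > 1" using p(1) prime_gt_1_nat by blast
    have pos: "a'\<^sup>2 + a' * b' + b'\<^sup>2 > 0"
      using eq True \<open>p > 1\<close> by (metis not_less of_nat_0_less_iff zero_less_mult_pos zero_less_power zero_less_one less_trans)
    then have M': "int M' = a'\<^sup>2 + a' * b' + b'\<^sup>2" by (simp add: M'_def)
    have M: "M = p\<^sup>2 * M'" using eq unfolding M'[symmetric] by (metis of_nat_eq_iff of_nat_mult of_nat_power)
    have "M' > 0" using pos M' by linarith
    then have "M' < M" unfolding M using \<open>p > 1\<close> using one_less_power[of p 2] by simp
    then have "even (multiplicity p M')" using M' by (rule less.IH)
    moreover have "multiplicity p M = 2 + multiplicity p M'"
      unfolding M using p(1) \<open>M' > 0\<close>
      by (subst prime_elem_multiplicity_mult_distrib) auto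
    ultimately show ?thesis by simp
  qed (auto intro: not_dvd_imp_multiplicity_0 simp: not_dvd_imp_multiplicity_0)
qed

lemma even_multiplicity_of_quadratic_form:
  fixes p n x y :: nat
  assumes p: "prime p" "[p = 2] (mod 3)" and eq: "24 * n + 4 = x\<^sup>2 + 3 * y\<^sup>2"
  shows "even (multiplicity p (6 * n + 1))"
proof (cases "p = 2")
  case True
  then show ?thesis by (simp add: not_dvd_imp_multiplicity_0)
next
  case False
  have "\<not> p dvd 2 ^ 2" using False p(1) by (metis prime_dvd_power primes_dvd_imp_eq two_is_prime_nat)
  have "multiplicity p (2 ^ 2 * (6 * n + 1)) = multiplicity p (2 ^ 2) + multiplicity p (6 * n + 1)"
    using p(1) by (intro prime_elem_multiplicity_mult_distrib) auto
  also have "multiplicity p (2 ^ 2) = 0" using \<open>\<not> p dvd 2 ^ 2\<close> by (rule not_dvd_imp_multiplicity_0)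
  finally have "multiplicity p (6 * n + 1) = multiplicity p (2 ^ 2 * (6 * n + 1))" by simp
  \<comment> \<open>The substitution \<open>a = x - y\<close>, \<open>b = 2 * y\<close> turns
    \<open>a\<^sup>2 + a * b + b\<^sup>2\<close> into
    \<open>x\<^sup>2 + 3 * y\<^sup>2\<close>.\<close>
  moreover have "int (2 ^ 2 * (6 * n + 1)) = (int x - int y)\<^sup>2 + (int x - int y) * (2 * int y) + (2 * int y)\<^sup>2"
  proof -
    have "2 ^ 2 * (6 * n + 1) = x\<^sup>2 + 3 * y\<^sup>2" using eq by simp
    then show ?thesis by (simp only:) (simp add: power2_eq_square algebra_simps)
  qed
  ultimately show ?thesis using even_multiplicity_quadratic_form[OF p] by metis
qed

section \<open>Primes congruent to 5 modulo 6\<close>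

definition chi6 :: "nat \<Rightarrow> real" where
  "chi6 n = (if n mod 6 = 1 then 1 else if n mod 6 = 5 then -1 else 0)"

lemma chi6_mult: "chi6 (m * n) = chi6 m * chi6 n"
proof -
  have "(m * n) mod 6 = (m mod 6) * (n mod 6) mod 6" by (simp add: mod_mult_eq)
  moreover have "m mod 6 \<in> {0, 1, 2, 3, 4, 5}" "n mod 6 \<in> {0, 1, 2, 3, 4, 5}" by auto
  ultimately show ?thesis unfolding chi6_def by auto
qed

text \<open>The nonzero terms 1 - 1/5 + 1/7 - 1/11 + ... alternate and decrease in absolute
  value.\<close>

lemma sum_chi6_le_1: "(\<Sum>n=1..x. chi6 n / n) \<le> 1"
proof -
  \<comment> \<open>Strengthened for the induction: whenever the next nonzero term is positive, it
    is added in advance.\<close>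
  have "(\<Sum>n=1..x. chi6 n / n) +
      (if x mod 6 = 0 then 1 / (x + 1) else if x mod 6 = 5 then 1 / (x + 2) else 0) \<le> 1"
  proof (induction x)
    case (Suc x)
    have "x mod 6 \<in> {0, 1, 2, 3, 4, 5}" by auto
    moreover have "1 / real (x + 3) \<le> 1 / real (x + 1)" by (simp add: frac_le)
    ultimately show ?case using Suc by (auto simp: chi6_def mod_Suc add_ac split: if_splits)
  qed simp
  moreover have "(if x mod 6 = 0 then 1 / (x + 1) else if x mod 6 = 5 then 1 / (x + 2) else 0) \<ge> (0::real)"
    by simp
  ultimately show ?thesis by linarith
qed

text \<open>The completely multiplicative function that agrees with \<open>chi6\<close> at the primes outside \<open>P\<close>
  and has the opposite values at the primes in \<open>P\<close>.\<close>
definition chi6_flip :: "nat set \<Rightarrow> nat \<Rightarrow> real" where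
  "chi6_flip P n = chi6 n * (-1) ^ (\<Sum>p\<in>P. multiplicity p n)"

definition primes_5_mod_6 :: "nat set \<Rightarrow> bool" where
  "primes_5_mod_6 P \<longleftrightarrow> finite P \<and> (\<forall>p\<in>P. prime p \<and> p mod 6 = 5)"

lemma chi6_flip_prime_mult:
  assumes P: "primes_5_mod_6 P" and p: "prime p" and "n > 0"
  shows "chi6_flip P (p * n) = (if p \<in> P then 1 else chi6 p) * chi6_flip P n"
proof -
  have fin: "finite P" using P by (simp add: primes_5_mod_6_def)
  have "multiplicity q (p * n) = (if q = p then 1 else 0) + multiplicity q n" if "q \<in> P" for q
  proof -
    have "prime q" using that P by (simp add: primes_5_mod_6_def)
    then have "multiplicity q (p * n) = multiplicity q p + multiplicity q n"
      using p \<open>n > 0\<close> by (intro prime_elem_multiplicity_mult_distrib) auto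
    then show ?thesis using \<open>prime q\<close> p by (simp add: prime_multiplicity_other)
  qed
  then have "(\<Sum>q\<in>P. multiplicity q (p * n)) = (if p \<in> P then 1 else 0) + (\<Sum>q\<in>P. multiplicity q n)"
    using fin by (simp add: sum.distrib)
  moreover have "chi6 p = -1" if "p \<in> P"
    using that P by (simp add: primes_5_mod_6_def chi6_def)
  ultimately show ?thesis by (simp add: chi6_flip_def chi6_mult power_add)
qed

lemma sum_multiples:
  fixes g :: "nat \<Rightarrow> 'a::comm_monoid_add"
  assumes "p > 0"
  shows "(\<Sum>n | n \<in> {1..x} \<and> p dvd n. g n) = (\<Sum>k=1..x div p. g (p * k))"
proof (rule sum.reindex_bij_betw[symmetric])
  show "bij_betw ((*) p) {1..x div p} {n. n \<in> {1..x} \<and> p dvd n}"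
    by (rule bij_betw_byWitness[where f' = "\<lambda>n. n div p"])
      (use assms in \<open>auto simp: less_eq_div_iff_mult_less_eq mult.commute elim!: dvdE\<close>)
qed

lemma sum_split_multiples:
  fixes g :: "nat \<Rightarrow> real"
  assumes "p > 0" and "\<And>n. n > 0 \<Longrightarrow> g (p * n) = c * g n"
  shows "(\<Sum>n=1..x. g n / n) =
    (\<Sum>n | n \<in> {1..x} \<and> \<not> p dvd n. g n / n) + c / p * (\<Sum>n=1..x div p. g n / n)"
proof -
  have "(\<Sum>n=1..x. g n / n) = (\<Sum>n | n \<in> {1..x} \<and> \<not> p dvd n. g n / n) + (\<Sum>n | n \<in> {1..x} \<and> p dvd n. g n / n)"
    by (subst sum.union_disjoint[symmetric]) (auto intro!: sum.cong)
  also have "(\<Sum>n | n \<in> {1..x} \<and> p dvd n. g n / n) = (\<Sum>k=1..x div p. c / p * (g k / k))"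
    unfolding sum_multiples[OF assms(1)] using assms by (intro sum.cong) auto
  finally show ?thesis by (simp add: sum_distrib_left)
qed

text \<open>Flipping the sign at \<open>p\<close> replaces the Euler factor
  \<open>1 / (1 + 1 / p)\<close> by \<open>1 / (1 - 1 / p)\<close>, so each inserted prime costs
  their ratio.\<close>

lemma sum_chi6_flip_le:
  assumes "primes_5_mod_6 P"
  shows "(\<Sum>n=1..x. chi6_flip P n / n) \<le> (\<Prod>p\<in>P. (1 + 1 / p) / (1 - 1 / p))"
proof -
  have "finite P" using assms by (simp add: primes_5_mod_6_def)
  then show ?thesis using assms
  proof (induction P arbitrary: x rule: finite_induct)
    case empty
    then show ?case using sum_chi6_le_1 by (simp add: chi6_flip_def)
  next
    case (insert p P)
    let ?T = "\<lambda>P x. \<Sum>n=1..x. chi6_flip P n / n"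
    define M where "M = (\<Prod>p\<in>P. (1 + 1 / real p) / (1 - 1 / p))"
    have P: "primes_5_mod_6 P" and p: "prime p" "p mod 6 = 5"
      using insert.prems by (auto simp: primes_5_mod_6_def)
    have "p > 1" using p prime_gt_1_nat by blast
    have M: "?T P x \<le> M" for x using insert.IH[OF P] unfolding M_def .
    have "M \<ge> 0" using M[of 0] by simp
    have chi_p: "chi6 p = -1" using p by (simp add: chi6_def)
    \<comment> \<open>Off the multiples of \<open>p\<close> both functions coincide, so that common
      part is eliminated.\<close>
    have rec: "?T (insert p P) x = ?T P x + 1 / p * ?T P (x div p) + 1 / p * ?T (insert p P) (x div p)" for x
    proof -
      have "chi6_flip (insert p P) (p * n) = 1 * chi6_flip (insert p P) n" if "n > 0" for n
        using chi6_flip_prime_mult[OF insert.prems p(1) that] by simp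
      then have 1: "?T (insert p P) x = (\<Sum>n | n \<in> {1..x} \<and> \<not> p dvd n. chi6_flip (insert p P) n / n) +
          1 / p * ?T (insert p P) (x div p)"
        using \<open>p > 1\<close> by (intro sum_split_multiples) auto
      have "chi6_flip P (p * n) = -1 * chi6_flip P n" if "n > 0" for n
        using chi6_flip_prime_mult[OF P p(1) that] insert.hyps chi_p by simp
      then have 2: "?T P x = (\<Sum>n | n \<in> {1..x} \<and> \<not> p dvd n. chi6_flip P n / n) + -1 / p * ?T P (x div p)"
        using \<open>p > 1\<close> by (intro sum_split_multiples) auto
      have "(\<Sum>n | n \<in> {1..x} \<and> \<not> p dvd n. chi6_flip (insert p P) n / n) =
          (\<Sum>n | n \<in> {1..x} \<and> \<not> p dvd n. chi6_flip P n / n)"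
        using insert.hyps by (intro sum.cong) (auto simp: chi6_flip_def not_dvd_imp_multiplicity_0)
      with 1 2 show ?thesis by simp
    qed
    have "?T (insert p P) x \<le> M * ((1 + 1 / p) / (1 - 1 / p))" for x
    proof (induction x rule: less_induct)
      case (less x)
      show ?case
      proof (cases "x = 0")
        case True
        then show ?thesis using \<open>M \<ge> 0\<close> \<open>p > 1\<close> by simp
      next
        case False
        then have "x div p < x" using \<open>p > 1\<close> by simp
        \<comment> \<open>The claimed bound \<open>B\<close> is the solution of
          \<open>B = M + M / p + B / p\<close>.\<close>
        have "?T (insert p P) x \<le> M + 1 / p * M + 1 / p * (M * ((1 + 1 / p) / (1 - 1 / p)))"
          unfolding rec[of x]
          by (intro add_mono mult_left_mono M less.IH[OF \<open>x div p < x\<close>]) simp_all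
        also have "\<dots> = M * ((1 + 1 / p) / (1 - 1 / p))"
          using \<open>p > 1\<close> by (simp add: field_simps)
        finally show ?thesis .
      qed
    qed
    then show ?case using insert.hyps unfolding M_def by (simp add: mult.commute)
  qed
qed

text \<open>After the flips no prime up to \<open>N\<close> has a negative value; multiplicativity
  does the rest.\<close>

lemma chi6_flip_all_primes:
  assumes "0 < n" "n \<le> N"
  shows "chi6_flip {p. prime p \<and> p mod 6 = 5 \<and> p \<le> N} n = \<bar>chi6 n\<bar>"
  using assms
proof (induction n rule: less_induct)
  case (less n)
  let ?P = "{p. prime p \<and> p mod 6 = 5 \<and> p \<le> N}"
  have P: "primes_5_mod_6 ?P" by (auto simp: primes_5_mod_6_def)
  show ?case
  proof (cases "n = 1")
    case True
    then show ?thesis by (simp add: chi6_flip_def chi6_def)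
  next
    case False
    then obtain p k where p: "prime p" and n: "n = p * k"
      using prime_factor_nat[of n] by (auto elim!: dvdE)
    have "k > 0" "p > 1" "p \<le> n" using less.prems p n prime_gt_1_nat by auto
    have "k < n" "k \<le> N" using \<open>p > 1\<close> \<open>k > 0\<close> less.prems n by (auto intro: order.trans[rotated])
    have "chi6_flip ?P n = (if p \<in> ?P then 1 else chi6 p) * \<bar>chi6 k\<bar>"
      unfolding n chi6_flip_prime_mult[OF P p \<open>k > 0\<close>]
      by (simp only: less.IH[OF \<open>k < n\<close> \<open>k > 0\<close> \<open>k \<le> N\<close>])
    also have "(if p \<in> ?P then 1 else chi6 p) = \<bar>chi6 p\<bar>"
      using p \<open>p \<le> n\<close> less.prems by (auto simp: chi6_def)
    finally show ?thesis by (simp add: n chi6_mult abs_mult)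
  qed
qed

text \<open>The \<open>n\<close> congruent to 1 modulo 6 already contribute a sixth of a harmonic
  number to the sum that the product bounds.\<close>

lemma primes_5_mod_6_product_unbounded:
  "\<exists>P. primes_5_mod_6 P \<and> B < (\<Prod>p\<in>P. (1 + 1 / real p) / (1 - 1 / p))"
proof -
  obtain K where K: "harm K > 6 * B"
    using harm_at_top by (auto simp: filterlim_at_top_dense eventually_sequentially)
  define P where "P = {p. prime p \<and> p mod 6 = 5 \<and> p \<le> 6 * K}"
  have P: "primes_5_mod_6 P" by (auto simp: primes_5_mod_6_def P_def)
  have "B < harm K / 6" using K by simp
  also have "harm K / 6 = (\<Sum>i<K. 1 / (6 * real (Suc i)))"
    by (simp add: harm_altdef sum_divide_distrib field_simps)
  also have "\<dots> \<le> (\<Sum>i<K. 1 / real (6 * i + 1))"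
    by (intro sum_mono frac_le) auto
  also have "\<dots> = (\<Sum>n\<in>(\<lambda>i. 6 * i + 1) ` {..<K}. \<bar>chi6 n\<bar> / real n)"
  proof -
    have "(6 * i + 1) mod 6 = 1" for i :: nat by presburger
    then show ?thesis by (subst sum.reindex) (auto simp: inj_on_def chi6_def)
  qed
  also have "\<dots> \<le> (\<Sum>n=1..6 * K. \<bar>chi6 n\<bar> / real n)"
    by (intro sum_mono2) auto
  also have "\<dots> = (\<Sum>n=1..6 * K. chi6_flip P n / real n)"
    by (intro sum.cong) (auto simp: P_def chi6_flip_all_primes)
  also have "\<dots> \<le> (\<Prod>p\<in>P. (1 + 1 / p) / (1 - 1 / p))"
    by (rule sum_chi6_flip_le[OF P])
  finally show ?thesis using P by blast
qed

text \<open>Each factor is the proportion of residues modulo \<open>p\<^sup>2\<close> that survive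
  the sieve; its cube is compared with the reciprocal of a factor of the unbounded product.\<close>

lemma primes_5_mod_6_density_product_small:
  assumes "\<epsilon> > 0"
  shows "\<exists>P. primes_5_mod_6 P \<and> (\<Prod>p\<in>P. 1 - 1 / real p + 1 / (real p)\<^sup>2) < \<epsilon>"
proof -
  obtain P where P: "primes_5_mod_6 P" and B: "1 / \<epsilon> ^ 3 < (\<Prod>p\<in>P. (1 + 1 / real p) / (1 - 1 / p))"
    using primes_5_mod_6_product_unbounded by blast
  have p5: "real p \<ge> 5" if "p \<in> P" for p
  proof -
    have "p mod 6 = 5" using that P by (simp add: primes_5_mod_6_def)
    then show ?thesis using mod_less_eq_dividend[of p 6] by simp
  qed
  \<comment> \<open>To first order this reads \<open>1 - 3 * t\<close> against
    \<open>1 - 2 * t\<close>; a square in place of the cube would fail at second order.\<close>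
  have ineq: "(1 - t + t\<^sup>2) ^ 3 \<le> (1 - t) / (1 + t)" if t: "0 \<le> t" "t \<le> 1 / 5" for t :: real
  proof -
    have tt: "t * t \<le> t * (1 / 5)" "t * t * t \<le> t * (1 / 5) * (1 / 5)"
      using t by (intro mult_mono mult_left_mono; simp)+
    have "1 - t + t\<^sup>2 \<le> 1 - 4 / 5 * t" using tt by (simp add: power2_eq_square)
    then have "(1 - t + t\<^sup>2)\<^sup>2 \<le> (1 - 4 / 5 * t)\<^sup>2" using t by (intro power_mono) auto
    also have "\<dots> \<le> 1 - 4 / 3 * t" using tt t by (simp add: power2_eq_square algebra_simps)
    \<comment> \<open>The third power comes from
      \<open>1 + t ^ 3 = (1 - t + t\<^sup>2) * (1 + t)\<close>.\<close>
    finally have "(1 - t + t\<^sup>2)\<^sup>2 * (1 + t ^ 3) \<le> (1 - 4 / 3 * t) * (1 + t / 25)"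
      using tt t by (intro mult_mono) (auto simp: power3_eq_cube)
    also have "\<dots> \<le> 1 - t" using t by (simp add: algebra_simps)
    also have "(1 - t + t\<^sup>2)\<^sup>2 * (1 + t ^ 3) = (1 - t + t\<^sup>2) ^ 3 * (1 + t)"
      by (simp add: power2_eq_square power3_eq_cube algebra_simps)
    finally show ?thesis using t by (simp add: field_simps)
  qed
  define D where "D = (\<Prod>p\<in>P. 1 - 1 / real p + 1 / (real p)\<^sup>2)"
  have "D ^ 3 \<le> (\<Prod>p\<in>P. (1 - 1 / real p) / (1 + 1 / p))"
    unfolding D_def prod_power_distrib
  proof (intro prod_mono conjI)
    fix p assume "p \<in> P"
    note 5 = p5[OF this]
    have t: "0 \<le> 1 / real p" "1 / real p \<le> 1 / 5" using 5 by (auto intro: frac_le)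
    show "(1 - 1 / real p + 1 / (real p)\<^sup>2) ^ 3 \<le> (1 - 1 / p) / (1 + 1 / p)"
      using ineq[OF t] by (simp add: power_one_over)
    show "0 \<le> (1 - 1 / real p + 1 / (real p)\<^sup>2) ^ 3"
      using t by (intro zero_le_power add_nonneg_nonneg) auto
  qed
  also have "\<dots> = 1 / (\<Prod>p\<in>P. (1 + 1 / real p) / (1 - 1 / p))"
    by (simp add: prod_dividef)
  also have "\<dots> < \<epsilon> ^ 3"
  proof -
    have "0 < 1 / \<epsilon> ^ 3" using assms by simp
    then have "0 < (\<Prod>p\<in>P. (1 + 1 / real p) / (1 - 1 / p))" using B by linarith
    then show ?thesis using B assms by (simp add: divide_less_eq mult.commute)
  qed
  finally have "D < \<epsilon>" using assms by (meson less_imp_le power_less_imp_less_base)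
  then show ?thesis using P unfolding D_def by blast
qed

section \<open>Sieving\<close>

text \<open>Rules out only multiplicity 1 among the odd ones; this depends on \<open>k\<close>
  modulo \<open>p\<^sup>2\<close> alone, so it can be sieved.\<close>

definition not_exactly_dvd :: "nat \<Rightarrow> nat \<Rightarrow> bool" where
  "not_exactly_dvd p k \<longleftrightarrow> (p dvd 6 * k + 1 \<longrightarrow> p\<^sup>2 dvd 6 * k + 1)"

lemma not_exactly_dvd_mod:
  assumes "p\<^sup>2 dvd M"
  shows "not_exactly_dvd p (k mod M) \<longleftrightarrow> not_exactly_dvd p k"
proof -
  have "[k mod M = k] (mod p\<^sup>2)" using assms by (meson cong_mod_left cong_refl cong_dvd_modulus_nat)
  then have 1: "[6 * (k mod M) + 1 = 6 * k + 1] (mod p\<^sup>2)"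
    by (intro cong_add cong_mult cong_refl)
  then have "[6 * (k mod M) + 1 = 6 * k + 1] (mod p)"
    by (rule cong_dvd_modulus_nat) simp
  with 1 show ?thesis unfolding not_exactly_dvd_def by (simp only: cong_dvd_iff)
qed

lemma card_not_exactly_dvd:
  assumes "prime p" "p mod 6 = 5"
  shows "card {k. k < p\<^sup>2 \<and> not_exactly_dvd p k} \<le> p\<^sup>2 - p + 1"
proof -
  define t where "t = p div 6"
  have p: "p = 6 * t + 5" using assms(2) unfolding t_def by presburger
  \<comment> \<open>The \<open>f i\<close> are the solutions of \<open>p dvd 6 * k + 1\<close>, with
    cofactor \<open>6 * i + 5\<close>. For \<open>i < p\<close> the cofactor is a multiple of
    \<open>p\<close> only at \<open>i = t\<close>, where it equals \<open>p\<close>.\<close>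
  define f where "f i = p * i + 5 * t + 4" for i
  have f: "6 * f i + 1 = p * (6 * i + 5)" for i
    by (simp add: f_def p algebra_simps)
  let ?A = "f ` ({..<p} - {t})"
  have inj: "inj_on f ({..<p} - {t})"
    using p by (auto simp: inj_on_def f_def)
  have "t \<in> {..<p}" using p by simp
  then have cardA: "card ?A = p - 1"
    using inj by (simp add: card_image)
  have sub: "?A \<subseteq> {k. k < p\<^sup>2 \<and> \<not> not_exactly_dvd p k}"
  proof safe
    fix i assume i: "i < p" "i \<noteq> t"
    have "p * Suc i \<le> p * p" using i by (intro mult_left_mono) auto
    moreover have "f i < p * Suc i" by (simp add: f_def p)
    ultimately show "f i < p\<^sup>2" by (simp add: power2_eq_square)
    assume "not_exactly_dvd p (f i)"
    then have "p\<^sup>2 dvd p * (6 * i + 5)" unfolding not_exactly_dvd_def f by simp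
    then have "p dvd 6 * i + 5" using p by (simp add: power2_eq_square)
    then have "[6 * i + 5 = 6 * t + 5] (mod p)" using p by (simp add: cong_def mod_0_imp_dvd)
    then have "[6 * i = 6 * t] (mod p)" by (simp only: cong_add_rcancel_nat)
    moreover have "coprime 6 p"
    proof -
      have "\<not> p dvd 2" "\<not> p dvd 3" using p by (auto dest!: dvd_imp_le)
      then have "\<not> p dvd 2 * 3" using assms(1) prime_dvd_multD by blast
      then show ?thesis using assms(1) by (simp add: coprime_commute prime_imp_coprime)
    qed
    ultimately have "[i = t] (mod p)" by (simp add: cong_mult_lcancel_nat)
    moreover have "t < p" using p by simp
    ultimately show False using i by (simp add: cong_def)
  qed
  have "{k. k < p\<^sup>2 \<and> not_exactly_dvd p k} \<subseteq> {..<p\<^sup>2} - ?A" using sub by auto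
  then have "card {k. k < p\<^sup>2 \<and> not_exactly_dvd p k} \<le> card ({..<p\<^sup>2} - ?A)"
    by (intro card_mono) auto
  also have "\<dots> = p\<^sup>2 - (p - 1)"
    using sub by (subst card_Diff_subset) (auto simp: cardA)
  also have "\<dots> \<le> p\<^sup>2 - p + 1" by simp
  finally show ?thesis .
qed

text \<open>Injectivity in the Chinese remainder theorem gives the upper bound.\<close>

lemma card_residues_coprime_le:
  fixes m n :: nat
  assumes "coprime m n" "m > 0" "n > 0"
  shows "card {k. k < m * n \<and> Q (k mod m) \<and> R (k mod n)} \<le> card {k. k < m \<and> Q k} * card {k. k < n \<and> R k}"
proof -
  have "inj_on (\<lambda>k. (k mod m, k mod n)) {k. k < m * n \<and> Q (k mod m) \<and> R (k mod n)}"
  proof (rule inj_onI)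
    fix x y assume x: "x \<in> {k. k < m * n \<and> Q (k mod m) \<and> R (k mod n)}"
      and y: "y \<in> {k. k < m * n \<and> Q (k mod m) \<and> R (k mod n)}"
      and eq: "(x mod m, x mod n) = (y mod m, y mod n)"
    have "[x = y] (mod m * n)" using eq assms by (intro coprime_cong_mult_nat) (auto simp: cong_def)
    then show "x = y" using x y by (simp add: cong_def)
  qed
  then have "card {k. k < m * n \<and> Q (k mod m) \<and> R (k mod n)} \<le> card ({k. k < m \<and> Q k} \<times> {k. k < n \<and> R k})"
    by (rule card_inj_on_le) (use assms in auto)
  then show ?thesis by (simp add: card_cartesian_product)
qed

lemma card_sieve_period:
  assumes "primes_5_mod_6 P"
  shows "card {k. k < (\<Prod>p\<in>P. p\<^sup>2) \<and> (\<forall>p\<in>P. not_exactly_dvd p k)} \<le> (\<Prod>p\<in>P. p\<^sup>2 - p + 1)"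
proof -
  have "finite P" using assms by (simp add: primes_5_mod_6_def)
  then show ?thesis using assms
  proof (induction P rule: finite_induct)
    case (insert p P)
    have P: "primes_5_mod_6 P" and p: "prime p" "p mod 6 = 5"
      using insert.prems by (auto simp: primes_5_mod_6_def)
    define M where "M = (\<Prod>p\<in>P. p\<^sup>2)"
    have "M > 0" unfolding M_def using P by (intro prod_pos) (auto simp: primes_5_mod_6_def prime_gt_0_nat)
    have dvdM: "q\<^sup>2 dvd M" if "q \<in> P" for q
      unfolding M_def using insert.hyps that by (intro dvd_prodI) auto
    have "coprime (p\<^sup>2) M" unfolding M_def
    proof (intro prod_coprime_right)
      fix q assume "q \<in> P"
      then have "prime q" "p \<noteq> q" using P insert.hyps by (auto simp: primes_5_mod_6_def)
      then show "coprime (p\<^sup>2) (q\<^sup>2)" using p by (simp add: primes_coprime)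
    qed
    have "{k. k < (\<Prod>p\<in>insert p P. p\<^sup>2) \<and> (\<forall>q\<in>insert p P. not_exactly_dvd q k)} =
        {k. k < p\<^sup>2 * M \<and> not_exactly_dvd p (k mod p\<^sup>2) \<and> (\<forall>q\<in>P. not_exactly_dvd q (k mod M))}"
      using insert.hyps dvdM by (auto simp: M_def[symmetric] not_exactly_dvd_mod)
    also have "card \<dots> \<le> card {k. k < p\<^sup>2 \<and> not_exactly_dvd p k} *
        card {k. k < M \<and> (\<forall>q\<in>P. not_exactly_dvd q k)}"
      using \<open>coprime (p\<^sup>2) M\<close> \<open>M > 0\<close> p by (intro card_residues_coprime_le) (auto simp: prime_gt_0_nat)
    also have "\<dots> \<le> (p\<^sup>2 - p + 1) * (\<Prod>p\<in>P. p\<^sup>2 - p + 1)"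
      using card_not_exactly_dvd[OF p] insert.IH[OF P] unfolding M_def by (intro mult_mono) auto
    finally show ?case using insert.hyps by simp
  qed simp
qed

text \<open>The last, possibly incomplete period is counted as a full one.\<close>

lemma card_periodic_le:
  assumes "M > 0" and "\<And>k. Q (k mod M) = Q k"
  shows "card {k. k \<le> n \<and> Q k} \<le> (n div M + 1) * card {k. k < M \<and> Q k}"
proof -
  have "card {k. k \<le> n \<and> Q k} \<le> card ({..n div M} \<times> {k. k < M \<and> Q k})"
  proof (rule card_inj_on_le)
    show "inj_on (\<lambda>k. (k div M, k mod M)) {k. k \<le> n \<and> Q k}"
      by (rule inj_onI) (metis Pair_inject div_mult_mod_eq)
    show "(\<lambda>k. (k div M, k mod M)) ` {k. k \<le> n \<and> Q k} \<subseteq> {..n div M} \<times> {k. k < M \<and> Q k}"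
      using assms by (auto simp: div_le_mono)
  qed simp
  then show ?thesis by (simp add: card_cartesian_product)
qed

text \<open>For fixed \<open>P\<close> the survivors have density at most \<open>W / M\<close>,
  small by choice of \<open>P\<close>, and the boundary error \<open>W / n\<close> fades.\<close>

lemma sieve_density_zero:
  fixes S :: "nat set"
  assumes S: "\<And>k p. k \<in> S \<Longrightarrow> prime p \<Longrightarrow> p mod 6 = 5 \<Longrightarrow> even (multiplicity p (6 * k + 1))"
  shows "(\<lambda>n. real (card {k. 1 \<le> k \<and> k \<le> n \<and> k \<in> S}) / real n) \<longlonglongrightarrow> 0"
proof (rule LIMSEQ_I)
  fix \<epsilon> :: real assume "\<epsilon> > 0"
  then obtain P where P: "primes_5_mod_6 P" and small: "(\<Prod>p\<in>P. 1 - 1 / real p + 1 / (real p)\<^sup>2) < \<epsilon> / 2"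
    using primes_5_mod_6_density_product_small[of "\<epsilon> / 2"] by auto
  define M where "M = (\<Prod>p\<in>P. p\<^sup>2)"
  define W where "W = (\<Prod>p\<in>P. p\<^sup>2 - p + 1)"
  have P1: "p > 1" if "p \<in> P" for p using P that by (auto simp: primes_5_mod_6_def prime_gt_1_nat)
  have "finite P" using P by (simp add: primes_5_mod_6_def)
  have "M > 0" unfolding M_def using P1 by (intro prod_pos) (metis less_trans zero_less_one zero_less_power)
  have WM: "real W / real M < \<epsilon> / 2"
  proof -
    have "real W / real M = (\<Prod>p\<in>P. real (p\<^sup>2 - p + 1) / real (p\<^sup>2))"
      by (simp add: W_def M_def prod_dividef)
    also have "\<dots> = (\<Prod>p\<in>P. 1 - 1 / real p + 1 / (real p)\<^sup>2)"
    proof (rule prod.cong)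
      fix p assume "p \<in> P"
      then have "p > 1" by (rule P1)
      then have "p \<le> p\<^sup>2" by (simp add: power2_eq_square)
      then have "real (p\<^sup>2 - p + 1) = (real p)\<^sup>2 - real p + 1" by (simp add: of_nat_diff)
      then show "real (p\<^sup>2 - p + 1) / real (p\<^sup>2) = 1 - 1 / real p + 1 / (real p)\<^sup>2"
        using \<open>p > 1\<close> by (simp add: field_simps power2_eq_square)
    qed simp
    finally show ?thesis using small by simp
  qed
  have bound: "real (card {k. 1 \<le> k \<and> k \<le> n \<and> k \<in> S}) / real n \<le> real W / real M + real W / real n"
    if "n > 0" for n
  proof -
    have "not_exactly_dvd p k" if "k \<in> S" "p \<in> P" for k p
    proof (rule ccontr)
      assume "\<not> not_exactly_dvd p k"
      then have "multiplicity p (6 * k + 1) = 1"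
        by (intro multiplicity_eqI) (auto simp: not_exactly_dvd_def numeral_2_eq_2)
      moreover have "even (multiplicity p (6 * k + 1))"
        using S that P by (simp add: primes_5_mod_6_def)
      ultimately show False by simp
    qed
    then have "card {k. 1 \<le> k \<and> k \<le> n \<and> k \<in> S} \<le> card {k. k \<le> n \<and> (\<forall>p\<in>P. not_exactly_dvd p k)}"
      by (intro card_mono) auto
    also have "\<dots> \<le> (n div M + 1) * card {k. k < M \<and> (\<forall>p\<in>P. not_exactly_dvd p k)}"
    proof (rule card_periodic_le[OF \<open>M > 0\<close>])
      fix k
      have "not_exactly_dvd p (k mod M) \<longleftrightarrow> not_exactly_dvd p k" if "p \<in> P" for p
        using \<open>finite P\<close> that unfolding M_def by (intro not_exactly_dvd_mod dvd_prodI) auto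
      then show "(\<forall>p\<in>P. not_exactly_dvd p (k mod M)) = (\<forall>p\<in>P. not_exactly_dvd p k)" by simp
    qed
    also have "\<dots> \<le> (n div M + 1) * W"
      using card_sieve_period[OF P] unfolding M_def W_def by (rule mult_left_mono) simp
    finally have "real (card {k. 1 \<le> k \<and> k \<le> n \<and> k \<in> S}) \<le> real ((n div M + 1) * W)"
      by (rule of_nat_mono)
    also have "\<dots> \<le> (real n / real M + 1) * real W"
      using of_nat_div_le_of_nat[of n M, where 'a = real]
      unfolding of_nat_mult of_nat_add of_nat_1 by (intro mult_right_mono add_mono) simp_all
    finally show ?thesis using \<open>n > 0\<close> \<open>M > 0\<close> by (simp add: field_simps)
  qed
  have "(\<lambda>n. real W / real n) \<longlonglongrightarrow> 0" by (rule lim_const_over_n)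
  then obtain N where N: "\<And>n. n \<ge> N \<Longrightarrow> \<bar>real W / real n\<bar> < \<epsilon> / 2"
    using LIMSEQ_D[of _ 0 "\<epsilon> / 2"] \<open>\<epsilon> > 0\<close> by fastforce
  show "\<exists>N. \<forall>n\<ge>N. norm (real (card {k. 1 \<le> k \<and> k \<le> n \<and> k \<in> S}) / real n - 0) < \<epsilon>"
  proof (intro exI allI impI)
    \<comment> \<open>\<open>Suc N\<close> ensures \<open>n > 0\<close>, as \<open>bound\<close>
      requires.\<close>
    fix n assume n: "n \<ge> Suc N"
    then have "n > 0" by simp
    have "\<bar>real W / real n\<bar> < \<epsilon> / 2" using N[of n] n by simp
    with bound[OF \<open>n > 0\<close>] WM
    have "real (card {k. 1 \<le> k \<and> k \<le> n \<and> k \<in> S}) / real n < \<epsilon>" by linarith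
    then show "norm (real (card {k. 1 \<le> k \<and> k \<le> n \<and> k \<in> S}) / real n - 0) < \<epsilon>" by simp
  qed
qed

section \<open>The parity criterion and the density of even values\<close>

lemma even_cp_5_1_6:
  assumes "prime p" "[p = 2] (mod 3)" "odd (multiplicity p (6 * n + 1))"
  shows "even (cp 5 1 6 n)"
  using assms odd_cp_5_1_6_imp_quadratic_form[of n] even_multiplicity_of_quadratic_form by blast

theorem theorem4p11:
  shows "((\<lambda>n::nat. real (card {k::nat. 1 \<le> k \<and> k \<le> n \<and> even (cp 5 1 6 k)}) / real n)
           \<longlonglongrightarrow> 1) \<and>
         (\<forall>n::nat. (\<exists>p::nat. prime p \<and> [p = 2] (mod 3) \<and> odd (multiplicity p (6 * n + 1)))
            \<longrightarrow> even (cp 5 1 6 n))"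
proof (intro conjI allI impI)
  define S where "S = {k. odd (cp 5 1 6 k)}"
  let ?o = "\<lambda>n. card {k. 1 \<le> k \<and> k \<le> n \<and> k \<in> S}"
  have "(\<lambda>n. real (?o n) / real n) \<longlonglongrightarrow> 0"
  proof (rule sieve_density_zero)
    fix k p :: nat assume "k \<in> S" and p: "prime p" "p mod 6 = 5"
    have "[p = 2] (mod 3)" using p(2) unfolding cong_def by presburger
    with \<open>k \<in> S\<close> p(1) show "even (multiplicity p (6 * k + 1))"
      using even_cp_5_1_6 by (auto simp: S_def)
  qed
  then have lim: "(\<lambda>n. 1 - real (?o n) / real n) \<longlonglongrightarrow> 1"
    by (auto intro: tendsto_eq_intros)
  have eq: "1 - real (?o n) / real n =
      real (card {k. 1 \<le> k \<and> k \<le> n \<and> even (cp 5 1 6 k)}) / real n" if "n \<ge> 1" for n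
  proof -
    have "{1..n} = {k. 1 \<le> k \<and> k \<le> n \<and> even (cp 5 1 6 k)} \<union> {k. 1 \<le> k \<and> k \<le> n \<and> k \<in> S}"
      by (auto simp: S_def)
    then have "card {1..n} = card {k. 1 \<le> k \<and> k \<le> n \<and> even (cp 5 1 6 k)} + ?o n"
      by (simp only:) (rule card_Un_disjoint; auto simp: S_def)
    then have "real n = real (card {k. 1 \<le> k \<and> k \<le> n \<and> even (cp 5 1 6 k)}) + real (?o n)"
      by simp
    then show ?thesis using that by (simp add: field_simps)
  qed
  \<comment> \<open>The equality fails at \<open>n = 0\<close>, where both quotients are 0 by
    convention.\<close>
  have "\<forall>\<^sub>F n in sequentially. 1 - real (?o n) / real n =
      real (card {k. 1 \<le> k \<and> k \<le> n \<and> even (cp 5 1 6 k)}) / real n"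
    using eventually_ge_at_top[of 1] by eventually_elim (rule eq)
  with lim show "(\<lambda>n. real (card {k. 1 \<le> k \<and> k \<le> n \<and> even (cp 5 1 6 k)}) / real n) \<longlonglongrightarrow> 1"
    by (rule Lim_transform_eventually)
next
  fix n :: nat assume "\<exists>p::nat. prime p \<and> [p = 2] (mod 3) \<and> odd (multiplicity p (6 * n + 1))"
  then show "even (cp 5 1 6 n)" using even_cp_5_1_6 by blast
qed

end
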